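(* Let $S$ be a regular AG-groupoid. Then the set of all intuitionistic fuzzy two-sided ideals of $S$, equipped with the product $\circ$, is a semilattice (that is, it is closed under $\circ$, and $\circ$ is associative, commutative and idempotent on it) with identity element $\delta$, where $\delta=(S_\delta,\Theta_\delta)$ with $S_\delta(x)=1$ and $\Theta_\delta(x)=0$ for all $x\in S$.
   Context: An AG-groupoid is a non-empty set $S$ with a binary operation satisfying the left invertive law $(ab)c=(cb)a$ for all $a,b,c\in S$ (no associativity is assumed). $S$ is regular if for every $a\in S$ there is $x\in S$ with $a=(ax)a$. An intuitionistic fuzzy set (IFS) of $S$ is a pair $A=(\mu_A,\gamma_A)$ of functions $\mu_A,\gamma_A:S\to[0,1]$ with $0\le \mu_A(x)+\gamma_A(x)\le 1$ for all $x\in S$. An IFS $A$ is an intuitionistic fuzzy left ideal if $\mu_A(xy)\ge\mu_A(y)$ and $\gamma_A(xy)\le\gamma_A(y)$ for all $x,y\in S$; an intuitionistic fuzzy right ideal if $\mu_A(xy)\ge\mu_A(x)$ and $\gamma_A(xy)\le\gamma_A(x)$ for all $x,y\in S$; an intuitionistic fuzzy two-sided ideal if it is both. The product of IFSs $A$ and $B$ is $A\circ B=(\mu_A\circ\mu_B,\gamma_A\circ\gamma_B)$, where $(\mu_A\circ\mu_B)(a)=\sup_{a=bc}\min\{\mu_A(b),\mu_B(c)\}$ if $a=bc$ for some $b,c\in S$ and $0$ otherwise, and $(\gamma_A\circ\gamma_B)(a)=\inf_{a=bc}\max\{\gamma_A(b),\gamma_B(c)\}$ if $a=bc$ for some $b,c\in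 S$ and $1$ otherwise. *)

theory Defs
  imports Complex_Main "HOL-Library.FuncSet"
begin

locale ag_groupoid =
  fixes S :: "'a set" and mult :: "'a \<Rightarrow> 'a \<Rightarrow> 'a"
  assumes nonempty: "S \<noteq> {}"
    and closed: "\<lbrakk>a \<in> S; b \<in> S\<rbrakk> \<Longrightarrow> mult a b \<in> S"
    and left_invertive:
      "\<lbrakk>a \<in> S; b \<in> S; c \<in> S\<rbrakk> \<Longrightarrow> mult (mult a b) c = mult (mult c b) a"

locale regular_ag_groupoid = ag_groupoid +
  assumes regular: "a \<in> S \<Longrightarrow> \<exists>x\<in>S. a = mult (mult a x) a"

text \<open>
  Functions on the carrier \<open>S\<close> are represented extensionally (constantly \<open>undefined\<close>
  outside \<open>S\<close>), so that HOL equality of pairs is equality of functions on \<open>S\<close>.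
\<close>

type_synonym 'a ifs = "('a \<Rightarrow> real) \<times> ('a \<Rightarrow> real)"

definition is_ifs :: "'a set \<Rightarrow> 'a ifs \<Rightarrow> bool" where
  "is_ifs S A \<longleftrightarrow>
     fst A \<in> S \<rightarrow>\<^sub>E {0..1} \<and> snd A \<in> S \<rightarrow>\<^sub>E {0..1} \<and>
     (\<forall>x\<in>S. 0 \<le> fst A x + snd A x \<and> fst A x + snd A x \<le> 1)"

definition if_left_ideal :: "'a set \<Rightarrow> ('a \<Rightarrow> 'a \<Rightarrow> 'a) \<Rightarrow> 'a ifs \<Rightarrow> bool" where
  "if_left_ideal S mult A \<longleftrightarrow> is_ifs S A \<and>
     (\<forall>x\<in>S. \<forall>y\<in>S. fst A (mult x y) \<ge> fst A y \<and> snd A (mult x y) \<le> snd A y)"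

definition if_right_ideal :: "'a set \<Rightarrow> ('a \<Rightarrow> 'a \<Rightarrow> 'a) \<Rightarrow> 'a ifs \<Rightarrow> bool" where
  "if_right_ideal S mult A \<longleftrightarrow> is_ifs S A \<and>
     (\<forall>x\<in>S. \<forall>y\<in>S. fst A (mult x y) \<ge> fst A x \<and> snd A (mult x y) \<le> snd A x)"

definition if_two_sided_ideals :: "'a set \<Rightarrow> ('a \<Rightarrow> 'a \<Rightarrow> 'a) \<Rightarrow> 'a ifs set" where
  "if_two_sided_ideals S mult = {A. if_left_ideal S mult A \<and> if_right_ideal S mult A}"

text \<open>
  For values in \<open>[0,1]\<close> the sets below are bounded, and they are non-empty in the first
  branch, so the real \<open>Sup\<close> and \<open>Inf\<close> are the genuine supremum and infimum.
\<close>

definition sup_min_prod ::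
  "'a set \<Rightarrow> ('a \<Rightarrow> 'a \<Rightarrow> 'a) \<Rightarrow> ('a \<Rightarrow> real) \<Rightarrow> ('a \<Rightarrow> real) \<Rightarrow> 'a \<Rightarrow> real" where
  "sup_min_prod S mult f g = (\<lambda>a\<in>S.
     if \<exists>b\<in>S. \<exists>c\<in>S. a = mult b c
     then Sup {min (f b) (g c) | b c. b \<in> S \<and> c \<in> S \<and> a = mult b c}
     else 0)"

definition inf_max_prod ::
  "'a set \<Rightarrow> ('a \<Rightarrow> 'a \<Rightarrow> 'a) \<Rightarrow> ('a \<Rightarrow> real) \<Rightarrow> ('a \<Rightarrow> real) \<Rightarrow> 'a \<Rightarrow> real" where
  "inf_max_prod S mult f g = (\<lambda>a\<in>S.
     if \<exists>b\<in>S. \<exists>c\<in>S. a = mult b c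
     then Inf {max (f b) (g c) | b c. b \<in> S \<and> c \<in> S \<and> a = mult b c}
     else 1)"

definition ifs_prod :: "'a set \<Rightarrow> ('a \<Rightarrow> 'a \<Rightarrow> 'a) \<Rightarrow> 'a ifs \<Rightarrow> 'a ifs \<Rightarrow> 'a ifs" where
  "ifs_prod S mult A B =
     (sup_min_prod S mult (fst A) (fst B), inf_max_prod S mult (snd A) (snd B))"

definition ifs_delta :: "'a set \<Rightarrow> 'a ifs" where
  "ifs_delta S = ((\<lambda>x\<in>S. 1), (\<lambda>x\<in>S. 0))"

text \<open>
  Carrier-relative counterparts of the type-based library locales
  \<open>semilattice\<close> and \<open>semilattice_neutr\<close>.
\<close>

locale semilattice_on =
  fixes X :: "'b set" and f :: "'b \<Rightarrow> 'b \<Rightarrow> 'b"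
  assumes closed: "\<lbrakk>A \<in> X; B \<in> X\<rbrakk> \<Longrightarrow> f A B \<in> X"
    and assoc: "\<lbrakk>A \<in> X; B \<in> X; C \<in> X\<rbrakk> \<Longrightarrow> f (f A B) C = f A (f B C)"
    and commute: "\<lbrakk>A \<in> X; B \<in> X\<rbrakk> \<Longrightarrow> f A B = f B A"
    and idem: "A \<in> X \<Longrightarrow> f A A = A"

locale semilattice_neutr_on = semilattice_on +
  fixes e :: 'b
  assumes neutral_closed: "e \<in> X"
    and left_neutral: "A \<in> X \<Longrightarrow> f e A = A"
    and right_neutral: "A \<in> X \<Longrightarrow> f A e = A"

end

theory Submission
  imports Defs
begin

text \<open>
  On two-sided ideals the product is the pointwise intersection
  \<open>(min \<mu>\<^sub>A \<mu>\<^sub>B, max \<gamma>\<^sub>A \<gamma>\<^sub>B)\<close>: every factorization \<open>a = b c\<close> contributes at most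
  \<open>min (\<mu>\<^sub>A a) (\<mu>\<^sub>B a)\<close> by the ideal inequalities, and the factorization \<open>a = (a x) a\<close>
  given by regularity attains this bound; dually for \<open>\<gamma>\<close>. All semilattice laws are then inherited
  from \<open>min\<close> and \<open>max\<close>.
\<close>

context regular_ag_groupoid
begin

lemma sup_min_prod_eq_min:
  assumes f: "\<And>x y. \<lbrakk>x \<in> S; y \<in> S\<rbrakk> \<Longrightarrow> f x \<le> f (mult x y)"
    and g: "\<And>x y. \<lbrakk>x \<in> S; y \<in> S\<rbrakk> \<Longrightarrow> g y \<le> g (mult x y)"
  shows "sup_min_prod S mult f g = (\<lambda>a\<in>S. min (f a) (g a))"
proof
  fix a
  show "sup_min_prod S mult f g a = (\<lambda>a\<in>S. min (f a) (g a)) a"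
  proof (cases "a \<in> S")
    case True
    then obtain x where x: "x \<in> S" "a = mult (mult a x) a"
      using regular by blast
    let ?T = "{min (f b) (g c) | b c. b \<in> S \<and> c \<in> S \<and> a = mult b c}"
    have ub: "t \<le> min (f a) (g a)" if t: "t \<in> ?T" for t
    proof -
      obtain b c where "t = min (f b) (g c)" "b \<in> S" "c \<in> S" "a = mult b c"
        using t by blast
      then show ?thesis
        using f[of b c] g[of b c] by auto
    qed
    have ax: "mult a x \<in> S"
      using True x closed by blast
    have mem: "min (f (mult a x)) (g a) \<in> ?T"
      using True ax x by blast
    \<comment> \<open>The bound \<open>ub\<close> gives one inequality; the other is
      \<open>f a \<le> f (mult a x)\<close>. So the bound is attained and \<open>Sup\<close> is a
      maximum.\<close>
    have "min (f (mult a x)) (g a) = min (f a) (g a)"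
      using ub[OF mem] f[OF True x(1)] by auto
    then have "Sup ?T = min (f a) (g a)"
      using mem ub by (metis (no_types, lifting) cSup_eq_maximum)
    \<comment> \<open>The same factorization rules out the default value 0.\<close>
    moreover have "\<exists>b\<in>S. \<exists>c\<in>S. a = mult b c"
      using True ax x by blast
    ultimately show ?thesis
      using True by (simp add: sup_min_prod_def)
  qed (simp add: sup_min_prod_def)
qed

lemma inf_max_prod_eq_max:
  assumes f: "\<And>x y. \<lbrakk>x \<in> S; y \<in> S\<rbrakk> \<Longrightarrow> f (mult x y) \<le> f x"
    and g: "\<And>x y. \<lbrakk>x \<in> S; y \<in> S\<rbrakk> \<Longrightarrow> g (mult x y) \<le> g y"
  shows "inf_max_prod S mult f g = (\<lambda>a\<in>S. max (f a) (g a))"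
proof
  fix a
  show "inf_max_prod S mult f g a = (\<lambda>a\<in>S. max (f a) (g a)) a"
  proof (cases "a \<in> S")
    case True
    then obtain x where x: "x \<in> S" "a = mult (mult a x) a"
      using regular by blast
    let ?T = "{max (f b) (g c) | b c. b \<in> S \<and> c \<in> S \<and> a = mult b c}"
    have lb: "max (f a) (g a) \<le> t" if t: "t \<in> ?T" for t
    proof -
      obtain b c where "t = max (f b) (g c)" "b \<in> S" "c \<in> S" "a = mult b c"
        using t by blast
      then show ?thesis
        using f[of b c] g[of b c] by auto
    qed
    have ax: "mult a x \<in> S"
      using True x closed by blast
    have mem: "max (f (mult a x)) (g a) \<in> ?T"
      using True ax x by blast
    have "max (f (mult a x)) (g a) = max (f a) (g a)"
      using lb[OF mem] f[OF True x(1)] by auto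
    then have "Inf ?T = max (f a) (g a)"
      using mem lb by (metis (no_types, lifting) cInf_eq_minimum)
    moreover have "\<exists>b\<in>S. \<exists>c\<in>S. a = mult b c"
      using True ax x by blast
    ultimately show ?thesis
      using True by (simp add: inf_max_prod_def)
  qed (simp add: inf_max_prod_def)
qed

text \<open>In \<open>a = mult b c\<close> the left factor belongs to \<open>A\<close> and the right
  one to \<open>B\<close>, so \<open>A\<close> needs the right ideal inequalities and
  \<open>B\<close> the left ones.\<close>

lemma ifs_prod_eq_inter:
  assumes "if_right_ideal S mult A" "if_left_ideal S mult B"
  shows "ifs_prod S mult A B =
    ((\<lambda>a\<in>S. min (fst A a) (fst B a)), (\<lambda>a\<in>S. max (snd A a) (snd B a)))"
  using assms
  by (simp add: ifs_prod_def sup_min_prod_eq_min inf_max_prod_eq_max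
      if_right_ideal_def if_left_ideal_def)

end

text \<open>For the bound on the sum: whichever of \<open>A\<close>, \<open>B\<close> supplies the
  larger \<gamma>, the smaller \<mu> is at most the \<mu> of that same set, so the sum stays below
  1.\<close>

lemma is_ifs_inter:
  assumes "is_ifs S A" "is_ifs S B"
  shows "is_ifs S ((\<lambda>a\<in>S. min (fst A a) (fst B a)), (\<lambda>a\<in>S. max (snd A a) (snd B a)))"
proof -
  have *: "0 \<le> fst C x \<and> 0 \<le> snd C x \<and> fst C x \<le> 1 \<and> snd C x \<le> 1 \<and> fst C x + snd C x \<le> 1"
    if "is_ifs S C" "x \<in> S" for C x
    using that by (auto simp: is_ifs_def PiE_iff)
  show ?thesis
    using *[OF assms(1)] *[OF assms(2)]
    by (fastforce simp: is_ifs_def min_def max_def)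
qed

context ag_groupoid
begin

lemma two_sided_ideals_inter:
  assumes "A \<in> if_two_sided_ideals S mult" "B \<in> if_two_sided_ideals S mult"
  shows "((\<lambda>a\<in>S. min (fst A a) (fst B a)), (\<lambda>a\<in>S. max (snd A a) (snd B a)))
    \<in> if_two_sided_ideals S mult"
  using assms is_ifs_inter[of S A B]
  by (auto simp: if_two_sided_ideals_def if_left_ideal_def if_right_ideal_def closed
      min.coboundedI1 min.coboundedI2 max.coboundedI1 max.coboundedI2)

lemma ifs_delta_two_sided_ideal: "ifs_delta S \<in> if_two_sided_ideals S mult"
  by (auto simp: if_two_sided_ideals_def if_left_ideal_def if_right_ideal_def is_ifs_def
      ifs_delta_def closed)

end

theorem theorem2:
  fixes S :: "'a set" and mult :: "'a \<Rightarrow> 'a \<Rightarrow> 'a"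
  assumes "regular_ag_groupoid S mult"
  shows "semilattice_neutr_on (if_two_sided_ideals S mult) (ifs_prod S mult) (ifs_delta S)"
proof -
  interpret regular_ag_groupoid S mult by fact
  let ?X = "if_two_sided_ideals S mult"
  have prod: "ifs_prod S mult A B =
      ((\<lambda>a\<in>S. min (fst A a) (fst B a)), (\<lambda>a\<in>S. max (snd A a) (snd B a)))"
    if "A \<in> ?X" "B \<in> ?X" for A B
    using that ifs_prod_eq_inter by (simp add: if_two_sided_ideals_def)
  have prod_closed: "ifs_prod S mult A B \<in> ?X" if "A \<in> ?X" "B \<in> ?X" for A B
    using two_sided_ideals_inter[OF that] prod[OF that] by simp
  \<comment> \<open>Extensionality gives equality with \<open>A\<close> off \<open>S\<close> as
    well; the range makes 1 neutral for \<open>min\<close> and 0 neutral for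
    \<open>max\<close>.\<close>
  have ext: "fst A \<in> S \<rightarrow>\<^sub>E {0..1}" "snd A \<in> S \<rightarrow>\<^sub>E {0..1}" if "A \<in> ?X" for A
    using that by (auto simp: if_two_sided_ideals_def if_left_ideal_def is_ifs_def)
  have comm: "ifs_prod S mult A B = ifs_prod S mult B A" if "A \<in> ?X" "B \<in> ?X" for A B
    using that by (simp add: prod min.commute max.commute)
  have delta: "ifs_prod S mult (ifs_delta S) A = A" if A: "A \<in> ?X" for A
    using ext[OF A] unfolding prod[OF ifs_delta_two_sided_ideal A]
    by (auto simp: ifs_delta_def prod_eq_iff fun_eq_iff PiE_iff extensional_def restrict_def)
  show ?thesis
  proof
    fix A B C
    assume A: "A \<in> ?X"
    show "ifs_prod S mult A A = A"
      using ext[OF A] by (simp add: prod A PiE_restrict)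
    show "ifs_prod S mult (ifs_delta S) A = A"
      using A by (rule delta)
    then show "ifs_prod S mult A (ifs_delta S) = A"
      using comm[OF A ifs_delta_two_sided_ideal] by simp
    assume B: "B \<in> ?X"
    show "ifs_prod S mult A B \<in> ?X"
      using A B by (rule prod_closed)
    show "ifs_prod S mult A B = ifs_prod S mult B A"
      using A B by (rule comm)
    assume C: "C \<in> ?X"
    have "ifs_prod S mult (ifs_prod S mult A B) C =
        ((\<lambda>a\<in>S. min (min (fst A a) (fst B a)) (fst C a)),
         (\<lambda>a\<in>S. max (max (snd A a) (snd B a)) (snd C a)))"
      \<comment> \<open>The outer product is expanded first, while the inner one still has the form
        for which \<open>prod_closed\<close> gives membership. Then \<open>restrict_ext\<close>
        reduces the claim to points of \<open>S\<close>, where the inner restriction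
        evaluates.\<close>
      unfolding prod[OF prod_closed[OF A B] C] unfolding prod[OF A B]
      by (auto intro!: restrict_ext)
    also have "\<dots> = ifs_prod S mult A (ifs_prod S mult B C)"
      unfolding prod[OF A prod_closed[OF B C]] unfolding prod[OF B C]
      by (auto intro!: restrict_ext simp: min.assoc max.assoc)
    finally show "ifs_prod S mult (ifs_prod S mult A B) C =
        ifs_prod S mult A (ifs_prod S mult B C)" .
  qed (rule ifs_delta_two_sided_ideal)
qed

end
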